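(* For every integer $n\ge2$ and $\theta\in(0,1)$, the resonance set $\mathcal{R}_n^\theta$ for the transmission probability $T_n(\theta,k)$ contains $n-1$ points $k_1(\theta),\dots,k_{n-1}(\theta)$, where, for $j=1,2,\dots,n-1$, $k_j(\theta)$ is the root of the equation $$\cos k_j=\frac{2\theta}{\theta^2+1}\cos\frac{\pi j}{n}$$ on the interval $(0,\pi)$. At these points, $T_n(\theta,k)$ reaches its global maximum, which is equal to $1$.
   Context: For an integer $n\ge1$, $\theta\in\mathbb{R}\setminus\{0\}$ and $k\in\mathbb{R}$, consider the scattering problem $$\psi''+k^2\psi=0\ \text{ on }\mathbb{R}\setminus\{0,1,\dots,n-1\},\qquad \psi(j+0)=\theta\psi(j-0),\quad \psi'(j+0)=\theta^{-1}\psi'(j-0),\quad j=0,\dots,n-1,$$ with left scattering solution $\psi_-(x)=e^{ikx}+r_n(\theta,k)e^{-ikx}$ for $x<0$ and $\psi_-(x)=t_n(\theta,k)e^{ikx}$ for $x>n-1$. The reflection amplitude $r_n$ and transmission amplitude $t_n$ are determined (for all $k\in\mathbb{R}$) by $$\begin{bmatrix} t_n(\theta,k)\\0\end{bmatrix}=M_n(\theta,k)\begin{bmatrix}1\\ r_n(\theta,k)\end{bmatrix},\qquad M_n(\theta,k)=M(\theta,(n-1)k)\cdots M(\theta,2k)\,M(\theta,k)\,M(\theta,0),$$ where $$M(\theta,z)=\frac1{2\theta}\begin{bmatrix}\theta^2+1&(\theta^2-1)e^{-2iz}\\(\theta^2-1)e^{2iz}&\theta^2+1\end{bmatrix}.$$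 The transmission probability is $T_n(\theta,k)=|t_n(\theta,k)|^2$. The values of $k$ at which the function $T_n(\theta,\cdot)$ reaches its local maxima are called transmission resonances; the resonance set $\mathcal{R}_n^\theta$ is the set of all transmission resonances in $(0,\pi)$. *)

theory Defs
  imports "HOL-Analysis.Analysis"
begin

definition step_matrix :: "real \<Rightarrow> real \<Rightarrow> complex^2^2" where
  "step_matrix \<theta> z = (1 / (2 * \<theta>)) *\<^sub>R
     vector [vector [of_real (\<theta>\<^sup>2 + 1), of_real (\<theta>\<^sup>2 - 1) * exp (- 2 * \<i> * of_real z)],
             vector [of_real (\<theta>\<^sup>2 - 1) * exp (2 * \<i> * of_real z), of_real (\<theta>\<^sup>2 + 1)]]"

text \<open>The ordered product \<open>M(\<theta>, (n-1) k) \<cdots> M(\<theta>, k) M(\<theta>, 0)\<close>,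
  with the factor of the leftmost barrier on the right.\<close>

primrec transfer_matrix :: "nat \<Rightarrow> real \<Rightarrow> real \<Rightarrow> complex^2^2" where
  "transfer_matrix 0 \<theta> k = mat 1"
| "transfer_matrix (Suc n) \<theta> k = step_matrix \<theta> (real n * k) ** transfer_matrix n \<theta> k"

definition scattering_amplitudes :: "nat \<Rightarrow> real \<Rightarrow> real \<Rightarrow> complex \<Rightarrow> complex \<Rightarrow> bool" where
  "scattering_amplitudes n \<theta> k t r \<longleftrightarrow>
     vector [t, 0] = transfer_matrix n \<theta> k *v vector [1, r]"

lemma transfer_matrix_pseudo_unitary:
  assumes "\<theta> \<noteq> 0"
  shows "transfer_matrix n \<theta> k $ 2 $ 2 = cnj (transfer_matrix n \<theta> k $ 1 $ 1) \<and>
         transfer_matrix n \<theta> k $ 2 $ 1 = cnj (transfer_matrix n \<theta> k $ 1 $ 2) \<and>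
         transfer_matrix n \<theta> k $ 1 $ 1 * cnj (transfer_matrix n \<theta> k $ 1 $ 1) -
         transfer_matrix n \<theta> k $ 1 $ 2 * cnj (transfer_matrix n \<theta> k $ 1 $ 2) = 1"
proof (induction n)
  case 0
  show ?case by (simp add: mat_def)
next
  case (Suc n)
  define a b where "a = transfer_matrix n \<theta> k $ 1 $ 1" and "b = transfer_matrix n \<theta> k $ 1 $ 2"
  define e where "e = exp (- 2 * \<i> * of_real (real n * k))"
  define p q :: complex where
    "p = of_real ((\<theta>\<^sup>2 + 1) / (2 * \<theta>))" and "q = of_real ((\<theta>\<^sup>2 - 1) / (2 * \<theta>))"
  have cnj_e: "cnj e = exp (2 * \<i> * of_real (real n * k))"
    by (simp add: e_def exp_cnj)
  have e: "e * cnj e = 1"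
    unfolding cnj_e unfolding e_def by (simp flip: exp_add)
  have "((\<theta>\<^sup>2 + 1) / (2 * \<theta>))\<^sup>2 - ((\<theta>\<^sup>2 - 1) / (2 * \<theta>))\<^sup>2 = 1"
    using assms by (simp add: field_simps power2_eq_square)
  then have pq: "p * p - q * q = 1"
    by (simp only: p_def q_def power2_eq_square of_real_mult[symmetric] of_real_diff[symmetric] of_real_1)
  have IH: "transfer_matrix n \<theta> k $ 2 $ 2 = cnj a" "transfer_matrix n \<theta> k $ 2 $ 1 = cnj b"
      "a * cnj a - b * cnj b = 1"
    using Suc by (auto simp: a_def b_def)
  have cpq: "cnj p = p" "cnj q = q" by (simp_all add: p_def q_def)
  have S: "step_matrix \<theta> (real n * k) $ 1 $ 1 = p" "step_matrix \<theta> (real n * k) $ 2 $ 2 = p"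
      "step_matrix \<theta> (real n * k) $ 1 $ 2 = q * e" "step_matrix \<theta> (real n * k) $ 2 $ 1 = q * cnj e"
    unfolding cnj_e unfolding e_def
    by (simp_all add: step_matrix_def p_def q_def scaleR_conv_of_real[where 'a = complex])
  have T: "transfer_matrix (Suc n) \<theta> k $ 1 $ 1 = p * a + q * e * cnj b"
      "transfer_matrix (Suc n) \<theta> k $ 1 $ 2 = p * b + q * e * cnj a"
      "transfer_matrix (Suc n) \<theta> k $ 2 $ 1 = q * cnj e * a + p * cnj b"
      "transfer_matrix (Suc n) \<theta> k $ 2 $ 2 = q * cnj e * b + p * cnj a"
    by (simp_all add: matrix_matrix_mult_def sum_2 S IH a_def[symmetric] b_def[symmetric])
  have "(p * a + q * e * cnj b) * (p * cnj a + q * cnj e * b)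
      - (p * b + q * e * cnj a) * (p * cnj b + q * cnj e * a)
      = (p * p - q * q * (e * cnj e)) * (a * cnj a - b * cnj b)"
    by (simp add: algebra_simps)
  also have "\<dots> = 1" using e pq IH(3) by simp
  finally show ?case unfolding T by (simp add: cpq)
qed

text \<open>The linear system determines both amplitudes, also at \<open>k = 0\<close>.\<close>

lemma scattering_amplitudes_ex1:
  assumes "\<theta> \<noteq> 0"
  shows "\<exists>!p. scattering_amplitudes n \<theta> k (fst p) (snd p)"
proof -
  define a b where "a = transfer_matrix n \<theta> k $ 1 $ 1" and "b = transfer_matrix n \<theta> k $ 1 $ 2"
  have M: "transfer_matrix n \<theta> k $ 2 $ 2 = cnj a" "transfer_matrix n \<theta> k $ 2 $ 1 = cnj b"
    and det: "a * cnj a - b * cnj b = 1"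
    using transfer_matrix_pseudo_unitary[OF assms, of n k] by (auto simp: a_def b_def)
  have "a \<noteq> 0"
  proof
    assume "a = 0"
    then have "b * cnj b = -1" using det by (simp add: minus_equation_iff)
    then have "complex_of_real ((cmod b)\<^sup>2) = of_real (-1)"
      by (simp only: complex_norm_square of_real_minus of_real_1)
    then have "(cmod b)\<^sup>2 = -1" by (metis of_real_eq_iff)
    then show False by (smt (verit) zero_le_power2)
  qed
  have "scattering_amplitudes n \<theta> k t r \<longleftrightarrow> r = - cnj b / cnj a \<and> t = a + b * r" for t r
    using \<open>a \<noteq> 0\<close> unfolding scattering_amplitudes_def
    by (auto simp: vec_eq_iff forall_2 matrix_vector_mult_def sum_2 M
        a_def[symmetric] b_def[symmetric] field_simps eq_neg_iff_add_eq_0)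
  then show ?thesis
    by (intro ex1I[of _ "(a + b * (- cnj b / cnj a), - cnj b / cnj a)"]) auto
qed

definition transmission_amplitude :: "nat \<Rightarrow> real \<Rightarrow> real \<Rightarrow> complex" where
  "transmission_amplitude n \<theta> k = (THE t. \<exists>r. scattering_amplitudes n \<theta> k t r)"

definition transmission_probability :: "nat \<Rightarrow> real \<Rightarrow> real \<Rightarrow> real" where
  "transmission_probability n \<theta> k = (cmod (transmission_amplitude n \<theta> k))\<^sup>2"

definition local_max_at :: "(real \<Rightarrow> real) \<Rightarrow> real \<Rightarrow> bool" where
  "local_max_at f x \<longleftrightarrow> (\<forall>\<^sub>F y in nhds x. f y \<le> f x)"

definition resonance_set :: "nat \<Rightarrow> real \<Rightarrow> real set" where
  "resonance_set n \<theta> = {k. 0 < k \<and> k < pi \<and> local_max_at (transmission_probability n \<theta>) k}"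

end

theory Submission
  imports Defs
begin

text \<open>Conjugating the barriers into the same position turns the transfer matrix into a power of a
  single matrix of determinant \<open>1\<close> and trace \<open>2 p cos k\<close>, where \<open>p = (\<theta>\<^sup>2 + 1) / (2 \<theta>)\<close>. Hence
  \<open>1 / T\<^sub>n = 1 + (p\<^sup>2 - 1) U\<^sub>n\<^sub>-\<^sub>1(p cos k)\<^sup>2\<close> with the Chebyshev polynomial \<open>U\<^sub>n\<^sub>-\<^sub>1\<close> of the second kind,
  whose \<open>n - 1\<close> simple real roots give the points with \<open>T\<^sub>n = 1\<close>. There are no other local maxima:
  if \<open>P\<close> is a nonconstant polynomial with only real roots, then \<open>\<bar>P(x + h) P(x - h)\<bar> < P(x)\<^sup>2\<close> for
  small \<open>h > 0\<close> unless \<open>P(x) = 0\<close>, so \<open>\<bar>P\<bar>\<close> has no local minimum off its roots.\<close>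

section \<open>Chebyshev polynomials of the second kind and their roots\<close>

text \<open>The index is shifted with respect to the usual convention: \<open>chebU n = U\<^sub>n\<^sub>-\<^sub>1\<close>.\<close>

fun chebU :: "nat \<Rightarrow> real poly" where
  "chebU 0 = 0"
| "chebU (Suc 0) = 1"
| "chebU (Suc (Suc n)) = [:0, 2:] * chebU (Suc n) - chebU n"

text \<open>Keeping \<open>sin t\<close> as a factor, rather than dividing by it, makes the identity
  valid at multiples of \<open>pi\<close> as well.\<close>

lemma chebU_cos: "poly (chebU n) (cos t) * sin t = sin (real n * t)"
proof (induction n rule: chebU.induct)
  case (3 n)
  have "poly (chebU (Suc (Suc n))) (cos t) * sin t = 2 * cos t * sin (real (Suc n) * t) - sin (real n * t)"
    using 3 by (simp add: algebra_simps)
  also have "\<dots> = sin (real (Suc (Suc n)) * t)"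
  proof -
    have "real (Suc (Suc n)) * t = real (Suc n) * t + t" "real n * t = real (Suc n) * t - t"
      by (simp_all add: algebra_simps)
    then show ?thesis by (simp only: sin_add sin_diff) (simp add: algebra_simps)
  qed
  finally show ?case .
qed simp_all

text \<open>In the recurrence, \<open>[:0, 2:]\<close> shifts the coefficients and doubles them,
  while the subtracted polynomial has too small a degree to reach the top coefficient.\<close>

lemma degree_coeff_chebU:
  "degree (chebU (Suc n)) \<le> n \<and> coeff (chebU (Suc n)) n = 2 ^ n"
proof (induction n rule: less_induct)
  case (less n)
  consider "n = 0" | "n = 1" | m where "n = Suc (Suc m)"
    by (metis One_nat_def not0_implies_Suc)
  then show ?case
  proof cases
    case 3
    have m: "degree (chebU (Suc m)) \<le> m" "degree (chebU (Suc (Suc m))) \<le> Suc m"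
        "coeff (chebU (Suc (Suc m))) (Suc m) = 2 ^ Suc m"
      using less[of m] less[of "Suc m"] 3 by auto
    have "degree ([:0, 2:] * chebU (Suc (Suc m))) \<le> Suc (Suc m)"
      using degree_mult_le[of "[:0, 2:]" "chebU (Suc (Suc m))"] m by simp
    moreover have "coeff (chebU (Suc m)) (Suc (Suc m)) = 0"
      using m by (intro coeff_eq_0) simp
    ultimately show ?thesis
      using m unfolding 3 chebU.simps(3)[of "Suc m"]
      by (auto intro!: degree_diff_le simp del: chebU.simps)
  qed simp_all
qed

lemma inj_on_cos_pi_div: "inj_on (\<lambda>j. cos (pi * real j / real n)) {1..n-1}"
proof (rule inj_onI)
  fix i j assume ij: "i \<in> {1..n-1}" "j \<in> {1..n-1}"
    and eq: "cos (pi * real i / real n) = cos (pi * real j / real n)"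
  have "0 \<le> pi * real m / real n \<and> pi * real m / real n \<le> pi" if "m \<in> {1..n-1}" for m
    using that by (auto simp: divide_le_eq)
  then have "pi * real i / real n = pi * real j / real n"
    using cos_inj_pi[OF _ _ _ _ eq] ij by blast
  then show "i = j" using ij by auto
qed

text \<open>Both sides have degree at most \<open>n - 1\<close>, the same coefficient there, and
  agree at the \<open>n - 1\<close> distinct nodes. Their difference has degree below
  \<open>n - 1\<close> but that many roots, so it vanishes.\<close>

lemma chebU_factorization:
  assumes "n \<ge> 1"
  shows "poly (chebU n) x = 2 ^ (n - 1) * (\<Prod>j=1..n-1. (x - cos (pi * real j / real n)))"
proof -
  define c where "c j = cos (pi * real j / real n)" for j
  define Q where "Q = smult (2 ^ (n - 1)) (\<Prod>j=1..n-1. [:- c j, 1:])"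
  obtain m where m: "n = Suc m" using assms by (cases n) auto
  have lead: "lead_coeff (\<Prod>j=1..n-1. [:- c j, 1:]) = 1"
    by (simp add: lead_coeff_prod)
  have deg: "degree (\<Prod>j=1..n-1. [:- c j, 1:]) = n - 1"
    by (subst degree_prod_eq_sum_degree) auto
  have "chebU n = Q"
  proof (rule poly_eqI_degree_lead_coeff)
    show "coeff (chebU n) (n - 1) = coeff Q (n - 1)" "degree (chebU n) \<le> n - 1"
      using degree_coeff_chebU[of m] lead unfolding deg by (auto simp: Q_def m)
    show "degree Q \<le> n - 1" using deg by (simp add: Q_def)
    show "n - 1 \<le> card (c ` {1..n-1})"
      using inj_on_cos_pi_div[of n] by (simp add: card_image c_def)
    fix z assume "z \<in> c ` {1..n-1}"
    then obtain j where j: "j \<in> {1..n-1}" "z = c j" by auto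
    \<comment> \<open>Strictly inside the interval the sine is nonzero, so it can be cancelled in
      \<open>chebU_cos\<close>.\<close>
    have "pi * real j / real n > 0" "pi * real j / real n < pi"
      using j by (auto simp: divide_less_eq)
    then have "sin (pi * real j / real n) \<noteq> 0" using sin_gt_zero by force
    moreover have "sin (real n * (pi * real j / real n)) = 0"
      using assms by (simp add: mult.commute)
    ultimately have "poly (chebU n) z = 0"
      using chebU_cos[of n "pi * real j / real n"] j by (simp add: c_def)
    moreover have "poly Q z = 0" using j by (auto simp: Q_def poly_prod)
    ultimately show "poly (chebU n) z = poly Q z" by simp
  qed
  then show ?thesis by (simp add: Q_def poly_prod c_def)
qed

lemma chebU_eq_0_iff:
  assumes "n \<ge> 1"
  shows "poly (chebU n) x = 0 \<longleftrightarrow> (\<exists>j\<in>{1..n-1}. x = cos (pi * real j / real n))"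
  by (auto simp: chebU_factorization[OF assms])

section \<open>Local minima of products of real linear factors\<close>

text \<open>Off the roots, pairing \<open>x + h\<close> with \<open>x - h\<close> turns each squared
  factor into \<open>(x - c j)^2 - h^2\<close>, which is smaller but still positive for small
  \<open>h\<close>. Minimality at both points would force the opposite inequality. An empty product
  is constant, hence \<open>A\<close> is nonempty.\<close>

lemma local_min_abs_prod_is_root:
  fixes c :: "'a \<Rightarrow> real"
  assumes "finite A" "A \<noteq> {}"
    and min: "\<forall>\<^sub>F y in nhds x. \<bar>\<Prod>j\<in>A. (x - c j)\<bar> \<le> \<bar>\<Prod>j\<in>A. (y - c j)\<bar>"
  shows "\<exists>j\<in>A. x = c j"
proof (rule ccontr)
  assume "\<not> (\<exists>j\<in>A. x = c j)"
  then have nz: "x - c j \<noteq> 0" if "j \<in> A" for j using that by auto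
  obtain d where d: "d > 0"
    "\<And>y. dist y x < d \<Longrightarrow> \<bar>\<Prod>j\<in>A. (x - c j)\<bar> \<le> \<bar>\<Prod>j\<in>A. (y - c j)\<bar>"
    using min unfolding eventually_nhds_metric by auto
  \<comment> \<open>Any \<open>h\<close> below \<open>e\<close> keeps \<open>x + h\<close> and
    \<open>x - h\<close> in the neighbourhood of minimality and is smaller than the distance from
    \<open>x\<close> to every root.\<close>
  define e where "e = Min (insert d ((\<lambda>j. \<bar>x - c j\<bar>) ` A))"
  have "e > 0" using assms(1) d nz by (auto simp: e_def)
  then obtain h where h: "0 < h" "h < e" using dense by blast
  have he: "h < d" "\<And>j. j \<in> A \<Longrightarrow> h < \<bar>x - c j\<bar>"
    using h assms(1) by (auto simp: e_def)
  let ?f = "\<lambda>y. \<bar>\<Prod>j\<in>A. (y - c j)\<bar>"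
  obtain i where "i \<in> A" using assms(2) by blast
  have "?f (x + h) * ?f (x - h) = (\<Prod>j\<in>A. \<bar>(x + h - c j) * (x - h - c j)\<bar>)"
    by (simp add: abs_prod abs_mult prod.distrib)
  also have "\<dots> < (\<Prod>j\<in>A. \<bar>x - c j\<bar> * \<bar>x - c j\<bar>)"
  proof -
    have less: "\<bar>(x + h - c j) * (x - h - c j)\<bar> < \<bar>x - c j\<bar> * \<bar>x - c j\<bar>" if j: "j \<in> A" for j
    proof -
      have "(x + h - c j) * (x - h - c j) = \<bar>x - c j\<bar> * \<bar>x - c j\<bar> - h * h"
        by (simp add: algebra_simps)
      moreover have "h * h < \<bar>x - c j\<bar> * \<bar>x - c j\<bar>"
        using he(2)[OF j] h by (intro mult_strict_mono) auto
      moreover have "h * h > 0" using h by simp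
      ultimately show ?thesis by linarith
    qed
    show ?thesis
    proof (rule prod_mono_strict[where i = i])
      fix j assume j: "j \<in> A"
      show "0 \<le> \<bar>(x + h - c j) * (x - h - c j)\<bar> \<and>
          \<bar>(x + h - c j) * (x - h - c j)\<bar> \<le> \<bar>x - c j\<bar> * \<bar>x - c j\<bar>"
        using less[OF j] by linarith
      show "0 < \<bar>x - c j\<bar> * \<bar>x - c j\<bar>" using nz[OF j] by (intro mult_pos_pos) simp_all
    qed (fact \<open>i \<in> A\<close> less[OF \<open>i \<in> A\<close>] assms(1))+
  qed
  also have "\<dots> = ?f x * ?f x" by (simp only: abs_prod prod.distrib)
  also have "\<dots> \<le> ?f (x + h) * ?f (x - h)"
    using d(2)[of "x + h"] d(2)[of "x - h"] h he(1) by (intro mult_mono) (auto simp: dist_real_def)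
  finally show False by simp
qed

section \<open>Closed forms of the transfer matrix and the transmission probability\<close>

text \<open>With \<open>W = diag(w, cnj w)\<close>, the step matrix at \<open>n k\<close> is
  \<open>W^n M(0) W^(-n)\<close>, so the ordered product telescopes to \<open>W^n B^n\<close> with
  \<open>B = W^(-1) M(0)\<close>. As \<open>B\<close> has determinant 1 and trace
  \<open>2 p cos k\<close>, Cayley-Hamilton expresses \<open>B^n\<close> through Chebyshev values.
  Writing the diagonal entry with \<open>s (Suc n)\<close> and \<open>s n\<close> lets the formula
  start at \<open>n = 0\<close>.\<close>

lemma transfer_matrix_chebU:
  fixes \<theta> k :: real
  assumes "\<theta> \<noteq> 0"
  defines "p \<equiv> (\<theta>\<^sup>2 + 1) / (2 * \<theta>)" and "q \<equiv> (\<theta>\<^sup>2 - 1) / (2 * \<theta>)"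
  defines "s \<equiv> \<lambda>n. complex_of_real (poly (chebU n) (p * cos k))" and "w \<equiv> cis (- k)"
  shows "transfer_matrix n \<theta> k $ 1 $ 1 = w ^ n * (s (Suc n) - of_real p * w * s n) \<and>
         transfer_matrix n \<theta> k $ 1 $ 2 = w ^ n * cnj w * of_real q * s n"
proof (induction n)
  case 0
  then show ?case by (simp add: s_def mat_def)
next
  case (Suc n)
  have pq: "of_real p * of_real p = 1 + of_real q * (of_real q :: complex)"
  proof -
    have "p * p = 1 + q * q"
      using assms(1) by (simp add: p_def q_def field_simps power2_eq_square)
    then show ?thesis by (metis of_real_1 of_real_add of_real_mult)
  qed
  have wv: "w * cnj w = 1" by (simp add: w_def cis_cnj cis_mult)
  have trace: "2 * complex_of_real (p * cos k) = of_real p * (w + cnj w)"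
    by (simp add: w_def complex_eq_iff)
  have srec: "s (Suc (Suc n)) = of_real p * (w + cnj w) * s (Suc n) - s n"
    by (simp add: s_def trace[symmetric])
  have e: "exp (- 2 * \<i> * of_real (real n * k)) = w ^ n * w ^ n"
    unfolding w_def by (simp add: cis_conv_exp exp_of_nat_mult[symmetric] exp_add[symmetric] algebra_simps)
  have S: "step_matrix \<theta> (real n * k) $ 1 $ 1 = of_real p"
      "step_matrix \<theta> (real n * k) $ 1 $ 2 = of_real q * (w ^ n * w ^ n)"
    unfolding e[symmetric]
    by (simp_all add: step_matrix_def p_def q_def scaleR_conv_of_real[where 'a = complex])
  have cs: "cnj (s m) = s m" for m by (simp add: s_def)
  have wn: "w ^ n * cnj w ^ n = 1"
    using wv by (simp add: power_mult_distrib[symmetric])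
  let ?a = "transfer_matrix n \<theta> k $ 1 $ 1" and ?b = "transfer_matrix n \<theta> k $ 1 $ 2"
  \<comment> \<open>Pseudo-unitarity supplies the second row as conjugates of the first, so the
    induction needs only two entries.\<close>
  have T: "transfer_matrix (Suc n) \<theta> k $ 1 $ 1 = of_real p * ?a + of_real q * (w ^ n * w ^ n) * cnj ?b"
      "transfer_matrix (Suc n) \<theta> k $ 1 $ 2 = of_real p * ?b + of_real q * (w ^ n * w ^ n) * cnj ?a"
    using transfer_matrix_pseudo_unitary[OF assms(1), of n k]
    by (simp_all add: matrix_matrix_mult_def sum_2 S)
  have "of_real p * ?a + of_real q * (w ^ n * w ^ n) * cnj ?b =
      of_real p * (w ^ n * (s (Suc n) - of_real p * w * s n)) +
      of_real q * w ^ n * (w ^ n * cnj w ^ n) * w * of_real q * s n"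
    using Suc by (simp add: cs mult_ac)
  also have "\<dots> = w ^ n * (of_real p * s (Suc n) - w * s n * (of_real p * of_real p - of_real q * of_real q))"
    unfolding wn by (simp add: algebra_simps)
  \<comment> \<open>Inserting \<open>w * cnj w = 1\<close> allows a factor \<open>w\<close> to be
    pulled out, after which \<open>srec\<close> applies.\<close>
  also have "\<dots> = w ^ n * (of_real p * (w * cnj w) * s (Suc n) - w * s n)"
    unfolding pq wv by simp
  also have "\<dots> = w ^ Suc n * (s (Suc (Suc n)) - of_real p * w * s (Suc n))"
    unfolding srec by (simp add: algebra_simps)
  finally have A: "transfer_matrix (Suc n) \<theta> k $ 1 $ 1 = w ^ Suc n * (s (Suc (Suc n)) - of_real p * w * s (Suc n))"
    unfolding T .
  have "of_real p * ?b + of_real q * (w ^ n * w ^ n) * cnj ?a =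
      of_real p * (w ^ n * cnj w * of_real q * s n) +
      of_real q * w ^ n * (w ^ n * cnj w ^ n) * (s (Suc n) - of_real p * cnj w * s n)"
    using Suc by (simp add: cs mult_ac)
  also have "\<dots> = w ^ n * (w * cnj w) * of_real q * s (Suc n)"
    unfolding wn wv by (simp add: algebra_simps)
  finally have "transfer_matrix (Suc n) \<theta> k $ 1 $ 2 = w ^ Suc n * cnj w * of_real q * s (Suc n)"
    unfolding T by (simp add: mult_ac)
  with A show ?case by simp
qed

text \<open>Eliminating \<open>r\<close> with the second row of the system gives
  \<open>t * cnj a = 1\<close>, the determinant. The same determinant gives
  \<open>\<bar>a\<bar>^2 = 1 + \<bar>b\<bar>^2\<close>.\<close>

lemma transmission_probability_eq_inverse:
  assumes "\<theta> \<noteq> 0"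
  shows "transmission_probability n \<theta> k = 1 / (1 + (cmod (transfer_matrix n \<theta> k $ 1 $ 2))\<^sup>2)"
proof -
  define a b where "a = transfer_matrix n \<theta> k $ 1 $ 1" and "b = transfer_matrix n \<theta> k $ 1 $ 2"
  have M: "transfer_matrix n \<theta> k $ 2 $ 2 = cnj a" "transfer_matrix n \<theta> k $ 2 $ 1 = cnj b"
    and det: "a * cnj a - b * cnj b = 1"
    using transfer_matrix_pseudo_unitary[OF assms, of n k] by (auto simp: a_def b_def)
  obtain t r where tr: "scattering_amplitudes n \<theta> k t r"
    and uniq: "\<And>t' r'. scattering_amplitudes n \<theta> k t' r' \<Longrightarrow> t' = t"
    using scattering_amplitudes_ex1[OF assms, of n k] by (metis fst_conv snd_conv)
  have t: "transmission_amplitude n \<theta> k = t"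
    unfolding transmission_amplitude_def using tr uniq by blast
  have t_eq: "t = a + b * r" and r_eq: "cnj b + cnj a * r = 0"
    using tr unfolding scattering_amplitudes_def
    by (auto simp: vec_eq_iff forall_2 matrix_vector_mult_def sum_2 M
        a_def[symmetric] b_def[symmetric])
  have "t * cnj a = a * cnj a - b * cnj b + b * (cnj b + cnj a * r)"
    unfolding t_eq by (simp add: algebra_simps)
  then have "t * cnj a = 1" using det r_eq by simp
  then have "(cmod t)\<^sup>2 * (cmod a)\<^sup>2 = 1"
    by (metis complex_mod_cnj norm_mult norm_one power_mult_distrib power_one)
  moreover have "(cmod a)\<^sup>2 = 1 + (cmod b)\<^sup>2"
  proof -
    have "complex_of_real ((cmod a)\<^sup>2) = of_real (1 + (cmod b)\<^sup>2)"
      using det by (simp add: complex_norm_square algebra_simps del: of_real_power)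
    then show ?thesis by (simp only: of_real_eq_iff)
  qed
  moreover have "1 + (cmod b)\<^sup>2 > 0" by (simp add: add_pos_nonneg)
  ultimately show ?thesis
    by (simp add: transmission_probability_def t b_def[symmetric] eq_divide_eq)
qed

lemma transmission_probability_chebU:
  assumes "\<theta> \<noteq> 0"
  shows "transmission_probability n \<theta> k =
    1 / (1 + (((\<theta>\<^sup>2 - 1) / (2 * \<theta>)) * poly (chebU n) ((\<theta>\<^sup>2 + 1) / (2 * \<theta>) * cos k))\<^sup>2)"
  unfolding transmission_probability_eq_inverse[OF assms]
    transfer_matrix_chebU[OF assms, THEN conjunct2]
  by (simp add: norm_mult norm_power power_mult_distrib power_divide norm_divide del: of_real_diff of_real_power of_real_divide of_real_mult)

section \<open>Identification of the resonances\<close>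

text \<open>A local maximum of the probability in \<open>k\<close> is a local minimum of the
  absolute value of \<open>chebU n\<close> in the variable \<open>p * cos k\<close>, because this
  substitution has a continuous local inverse on \<open>(0, pi)\<close>. The minimum is then a
  root.\<close>

lemma transmission_resonance_is_root:
  fixes \<theta> k :: real
  assumes n: "n \<ge> 2" and \<theta>: "0 < \<theta>" "\<theta> < 1" and k: "k \<in> resonance_set n \<theta>"
  defines "p \<equiv> (\<theta>\<^sup>2 + 1) / (2 * \<theta>)"
  shows "poly (chebU n) (p * cos k) = 0"
proof -
  define q where "q = (\<theta>\<^sup>2 - 1) / (2 * \<theta>)"
  define c where "c j = cos (pi * real j / real n)" for j
  have p: "p > 0" using \<theta> by (auto simp: p_def intro!: divide_pos_pos add_nonneg_pos)
  have q: "q \<noteq> 0" using \<theta> power2_eq_1_iff[of \<theta>] by (auto simp: q_def)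
  have T: "transmission_probability n \<theta> y = 1 / (1 + (q * poly (chebU n) (p * cos y))\<^sup>2)" for y
    using transmission_probability_chebU[of \<theta> n y] \<theta> by (simp add: p_def q_def)
  have k: "0 < k" "k < pi" and max: "\<forall>\<^sub>F y in nhds k. transmission_probability n \<theta> y \<le> transmission_probability n \<theta> k"
    using k by (auto simp: resonance_set_def local_max_at_def)
  have cosk: "-1 < cos k" "cos k < 1"
    using k cos_monotone_0_pi[of 0 k] cos_monotone_0_pi[of k pi] by auto
  \<comment> \<open>Local inverse of \<open>p * cos\<close>; it is continuous at
    \<open>p * cos k\<close> because \<open>cos k\<close> lies strictly between -1 and 1.\<close>
  define g where "g y = arccos (y / p)" for y
  have gk: "g (p * cos k) = k" using p k by (simp add: g_def arccos_cos)
  have "isCont g (p * cos k)"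
    unfolding g_def using p cosk by (intro continuous_intros isCont_arccos[THEN isCont_o2[rotated]]) auto
  then have "filterlim g (nhds k) (nhds (p * cos k))"
    unfolding isCont_def tendsto_at_iff_tendsto_nhds by (simp only: gk)
  then have 1: "\<forall>\<^sub>F y in nhds (p * cos k). transmission_probability n \<theta> (g y) \<le> transmission_probability n \<theta> k"
    using max by (auto simp: filterlim_iff)
  \<comment> \<open>On this interval \<open>p * cos (g y) = y\<close>, so the bound on probabilities
    becomes one on values of \<open>chebU n\<close>.\<close>
  have "\<forall>\<^sub>F y in nhds (p * cos k). y \<in> {-p<..<p}"
    using mult_strict_left_mono[OF cosk(1) p] mult_strict_left_mono[OF cosk(2) p]
    by (intro eventually_nhds_in_open) auto
  then have "\<forall>\<^sub>F y in nhds (p * cos k). \<bar>poly (chebU n) (p * cos k)\<bar> \<le> \<bar>poly (chebU n) y\<bar>"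
    using 1
  proof eventually_elim
    case (elim y)
    have "p * cos (g y) = y"
      using elim(1) p by (simp add: g_def cos_arccos le_divide_eq divide_le_eq)
    then have "1 / (1 + (q * poly (chebU n) y)\<^sup>2) \<le> 1 / (1 + (q * poly (chebU n) (p * cos k))\<^sup>2)"
      using elim(2) by (simp add: T)
    moreover have "1 / (1 + u\<^sup>2) \<le> 1 / (1 + v\<^sup>2) \<longleftrightarrow> v\<^sup>2 \<le> u\<^sup>2" for u v :: real
    proof -
      have "1 + u\<^sup>2 > 0" "1 + v\<^sup>2 > 0" by (simp_all add: add_pos_nonneg)
      then show ?thesis by (simp add: divide_le_eq le_divide_eq)
    qed
    ultimately have "(q * poly (chebU n) (p * cos k))\<^sup>2 \<le> (q * poly (chebU n) y)\<^sup>2"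
      by blast
    then show ?case using q by (simp add: abs_le_square_iff[symmetric] abs_mult)
  qed
  \<comment> \<open>The positive constant \<open>2 ^ (n - 1)\<close> of the factorization cancels;
    \<open>n \<ge> 2\<close> makes the index set nonempty.\<close>
  then have "\<forall>\<^sub>F y in nhds (p * cos k). \<bar>\<Prod>j=1..n-1. (p * cos k - c j)\<bar> \<le> \<bar>\<Prod>j=1..n-1. (y - c j)\<bar>"
    using n by (simp add: chebU_factorization abs_mult c_def)
  then have "\<exists>j\<in>{1..n-1}. p * cos k = c j"
    using n by (intro local_min_abs_prod_is_root) auto
  then show ?thesis using n by (simp add: chebU_eq_0_iff c_def)
qed

theorem theorem4:
  fixes n :: nat and \<theta> :: real
  assumes "n \<ge> 2" and "0 < \<theta>" and "\<theta> < 1"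
  shows "\<exists>\<kappa> :: nat \<Rightarrow> real.
    (\<forall>j\<in>{1..n-1}.
       {x. 0 < x \<and> x < pi \<and> cos x = 2 * \<theta> / (\<theta>\<^sup>2 + 1) * cos (pi * real j / real n)} = {\<kappa> j}) \<and>
    inj_on \<kappa> {1..n-1} \<and>
    resonance_set n \<theta> = \<kappa> ` {1..n-1} \<and>
    (\<forall>j\<in>{1..n-1}. transmission_probability n \<theta> (\<kappa> j) = 1 \<and>
       (\<forall>k. transmission_probability n \<theta> k \<le> transmission_probability n \<theta> (\<kappa> j)))"
proof -
  define c where "c j = cos (pi * real j / real n)" for j
  define m where "m = 2 * \<theta> / (\<theta>\<^sup>2 + 1)"
  define p where "p = (\<theta>\<^sup>2 + 1) / (2 * \<theta>)"
  define \<kappa> where "\<kappa> j = arccos (m * c j)" for j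
  have D: "0 < \<theta>\<^sup>2 + 1" by (simp add: add_nonneg_pos)
  have pm: "p * (m * x) = x" for x using D assms(2) by (simp add: p_def m_def)
  have m_eq: "p * x = y \<longleftrightarrow> x = m * y" for x y
    using D assms(2) by (auto simp: p_def m_def field_simps)
  \<comment> \<open>Expanded, this says \<open>2 * \<theta> < \<theta>^2 + 1\<close>, that is
    \<open>m < 1\<close>. Hence \<open>m * c j\<close> stays off the endpoints -1 and 1, and every
    \<open>\<kappa> j\<close> lies in the open interval.\<close>
  have "(1 - \<theta>)\<^sup>2 > 0" using assms(3) by simp
  then have m: "0 < m" "m < 1"
    using D assms(2) by (auto simp: m_def power2_eq_square algebra_simps)
  have bound: "-1 < m * c j" "m * c j < 1" for j
  proof -
    have "\<bar>m * c j\<bar> \<le> m" using m by (simp add: abs_mult c_def mult_left_le)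
    then show "-1 < m * c j" "m * c j < 1" using m by linarith+
  qed
  have cos\<kappa>: "cos (\<kappa> j) = m * c j" for j
    using bound[of j] by (simp add: \<kappa>_def cos_arccos)
  have \<kappa>: "0 < \<kappa> j" "\<kappa> j < pi" for j
    using arccos_lt_bounded[OF bound, of j] by (auto simp: \<kappa>_def)
  have roots: "x = \<kappa> j" if "0 < x" "x < pi" "cos x = m * c j" for x j
    using that arccos_cos[of x] by (simp add: \<kappa>_def)
  have T: "transmission_probability n \<theta> k = 1 / (1 + ((\<theta>\<^sup>2 - 1) / (2 * \<theta>) * poly (chebU n) (p * cos k))\<^sup>2)" for k
    using transmission_probability_chebU assms(2) by (simp add: p_def)
  have T_le: "transmission_probability n \<theta> k \<le> 1" for k
    unfolding T by (simp add: divide_le_eq add_pos_nonneg)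
  have T\<kappa>: "transmission_probability n \<theta> (\<kappa> j) = 1" if "j \<in> {1..n-1}" for j
  proof -
    have "poly (chebU n) (p * cos (\<kappa> j)) = 0"
      using that assms(1) unfolding cos\<kappa> pm by (auto simp: chebU_eq_0_iff c_def)
    then show ?thesis unfolding T by simp
  qed
  \<comment> \<open>Every resonance is a root, hence some \<open>\<kappa> j\<close>. Conversely, the
    value 1 attained at \<open>\<kappa> j\<close> is a global bound, hence a local maximum.\<close>
  have "resonance_set n \<theta> = \<kappa> ` {1..n-1}"
  proof (intro equalityI subsetI)
    fix k assume k: "k \<in> resonance_set n \<theta>"
    then obtain j where "j \<in> {1..n-1}" "p * cos k = c j"
      using transmission_resonance_is_root[OF assms k] assms(1)
      by (auto simp: chebU_eq_0_iff c_def p_def)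
    then show "k \<in> \<kappa> ` {1..n-1}"
      using roots[of k j] k by (auto simp: m_eq resonance_set_def)
  next
    fix k assume "k \<in> \<kappa> ` {1..n-1}"
    then show "k \<in> resonance_set n \<theta>"
      using \<kappa> T\<kappa> T_le by (auto simp: resonance_set_def local_max_at_def)
  qed
  moreover have "inj_on \<kappa> {1..n-1}"
  proof (rule inj_onI)
    fix i j assume ij: "i \<in> {1..n-1}" "j \<in> {1..n-1}" "\<kappa> i = \<kappa> j"
    then have "m * c i = m * c j" by (metis cos\<kappa>)
    then show "i = j" using ij m inj_onD[OF inj_on_cos_pi_div[of n], of i j] by (simp add: c_def)
  qed
  moreover have "{x. 0 < x \<and> x < pi \<and> cos x = 2 * \<theta> / (\<theta>\<^sup>2 + 1) * cos (pi * real j / real n)} = {\<kappa> j}" for j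
    unfolding c_def[symmetric] m_def[symmetric] using roots \<kappa> cos\<kappa> by blast
  moreover have "\<forall>j\<in>{1..n-1}. transmission_probability n \<theta> (\<kappa> j) = 1 \<and>
      (\<forall>k. transmission_probability n \<theta> k \<le> transmission_probability n \<theta> (\<kappa> j))"
    using T\<kappa> T_le by simp
  ultimately show ?thesis by blast
qed

end
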